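(* Let $S$ be a Noetherian commutative ring, and let $\mathfrak{a}_\bullet$ and $\mathfrak{b}_\bullet$ be filtrations of ideals in $S$. Then the topology $\tau_{\mathfrak{a}}$ is linearly finer than the topology $\tau_{\mathfrak{b}}$ if and only if $\rho(\mathfrak{a}_\bullet,\mathfrak{b}_\bullet)<\infty$.
   Context: $\mathbb{N}$ denotes the positive integers. A filtration of ideals in $S$ is a collection $\mathfrak{a}_\bullet=\{\mathfrak{a}_i\}_{i\ge 1}$ of ideals with $\mathfrak{a}_p\mathfrak{a}_q\subseteq\mathfrak{a}_{p+q}$ and $\mathfrak{a}_p\supseteq\mathfrak{a}_{p+1}$ for all $p,q\ge 1$; by convention $\mathfrak{a}_0=S$. The filtration $\mathfrak{a}_\bullet$ defines a topology $\tau_{\mathfrak{a}}$ on the additive group $(S,+)$ in which $\{x+\mathfrak{a}_i\}_{i\ge0}$ is a basis of open neighborhoods of $x\in S$. The topology $\tau_{\mathfrak{a}}$ given by $\mathfrak{a}_\bullet$ is said to be linearly finer than $\tau_{\mathfrak{b}}$ given by $\mathfrak{b}_\bullet$ if there exists a linear function $f(x)=ax+b\in\mathbb{Z}_{\ge0}[x]$ such that $\mathfrak{a}_{f(i)}\subseteq\mathfrak{b}_i$ for all $i\ge0$. The resurgence number is $$\rho(\mathfrak{a}_\bullet,\mathfrak{b}_\bullet)=\sup\left\{\tfrac{s}{r}\mid s,r\in\mathbb{N},\ \mathfrak{a}_s\not\subseteq\mathfrak{b}_r\right\},$$ with values in the extended reals and $\sup\varnothing=-\infty$ (so the value $-\infty$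 counts as $<\infty$). *)

theory Defs
  imports
    "HOL-Algebra.Ideal_Product"
    "HOL-Algebra.Ring_Divisibility"
    "HOL-Analysis.Abstract_Topology"
    "HOL-Library.Extended_Real"
begin

text \<open>
  The family is indexed by all natural numbers; the value at \<open>0\<close> carries the convention that
  the zeroth ideal is the whole ring, while the remaining conditions concern positive indices only.
\<close>

locale ideal_filtration = cring R for R (structure) +
  fixes \<aa> :: "nat \<Rightarrow> 'a set"
  assumes filtration_0: "\<aa> 0 = carrier R"
    and filtration_ideal: "i \<ge> 1 \<Longrightarrow> ideal (\<aa> i) R"
    and filtration_mult: "\<lbrakk>p \<ge> 1; q \<ge> 1\<rbrakk> \<Longrightarrow> \<aa> p \<cdot> \<aa> q \<subseteq> \<aa> (p + q)"
    and filtration_Suc: "p \<ge> 1 \<Longrightarrow> \<aa> (p + 1) \<subseteq> \<aa> p"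

definition filtration_topology :: "('a, 'm) ring_scheme \<Rightarrow> (nat \<Rightarrow> 'a set) \<Rightarrow> 'a topology" where
  "filtration_topology R \<aa> =
     topology (\<lambda>U. U \<subseteq> carrier R \<and> (\<forall>x\<in>U. \<exists>i. x <+\<^bsub>R\<^esub> \<aa> i \<subseteq> U))"

text \<open>
  Being linearly finer depends on the filtrations presenting the two topologies, not only on the
  topologies themselves, so it is a relation between filtrations: \<open>linearly_finer \<aa> \<bb>\<close>
  says that the topology given by \<open>\<aa>\<close> is linearly finer than the one given by \<open>\<bb>\<close>.
\<close>

definition linearly_finer :: "(nat \<Rightarrow> 'a set) \<Rightarrow> (nat \<Rightarrow> 'a set) \<Rightarrow> bool" where
  "linearly_finer \<aa> \<bb> \<longleftrightarrow> (\<exists>m c :: nat. \<forall>i. \<aa> (m * i + c) \<subseteq> \<bb> i)"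

text \<open>In \<^typ>\<open>ereal\<close> the supremum of the empty set is \<open>-\<infinity>\<close>.\<close>

definition resurgence :: "(nat \<Rightarrow> 'a set) \<Rightarrow> (nat \<Rightarrow> 'a set) \<Rightarrow> ereal" where
  "resurgence \<aa> \<bb> =
     Sup {ereal (real s / real r) | s r. s \<ge> 1 \<and> r \<ge> 1 \<and> \<not> \<aa> s \<subseteq> \<bb> r}"

context ideal_filtration
begin

lemma ideal_filtration: "ideal (\<aa> i) R"
  by (cases "i = 0") (auto simp: filtration_0 oneideal intro: filtration_ideal)

lemma filtration_antimono: "i \<le> j \<Longrightarrow> \<aa> j \<subseteq> \<aa> i"
proof (induction j rule: dec_induct)
  case (step n)
  have "\<aa> (Suc n) \<subseteq> \<aa> n"
  proof (cases "n = 0")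
    case True
    then show ?thesis
      using ideal.Icarr[OF ideal_filtration] by (auto simp: filtration_0)
  next
    case False
    then show ?thesis using filtration_Suc[of n] by simp
  qed
  with step show ?case by blast
qed simp

lemma coset_mono: "i \<le> j \<Longrightarrow> x <+ \<aa> j \<subseteq> x <+ \<aa> i"
  using filtration_antimono[of i j] by (auto simp: a_l_coset_def')

lemma openin_filtration_topology:
  "openin (filtration_topology R \<aa>) U \<longleftrightarrow>
     U \<subseteq> carrier R \<and> (\<forall>x\<in>U. \<exists>i. x <+ \<aa> i \<subseteq> U)"
proof -
  let ?L = "\<lambda>U. U \<subseteq> carrier R \<and> (\<forall>x\<in>U. \<exists>i. x <+ \<aa> i \<subseteq> U)"
  have "?L (S \<inter> T)" if "?L S" "?L T" for S T
  proof (intro conjI ballI)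
    fix x assume "x \<in> S \<inter> T"
    with that obtain i j where "x <+ \<aa> i \<subseteq> S" "x <+ \<aa> j \<subseteq> T" by blast
    then have "x <+ \<aa> (max i j) \<subseteq> S \<inter> T"
      using coset_mono[of i "max i j" x] coset_mono[of j "max i j" x] by auto
    then show "\<exists>k. x <+ \<aa> k \<subseteq> S \<inter> T" ..
  qed (use that in blast)
  moreover have "?L (\<Union>K)" if "\<forall>S\<in>K. ?L S" for K
    using that by (meson Sup_least UnionE Union_upper order_trans)
  ultimately have "istopology ?L"
    unfolding istopology_def by blast
  then show ?thesis
    by (simp add: filtration_topology_def)
qed

lemma openin_coset:
  assumes "x \<in> carrier R"
  shows "openin (filtration_topology R \<aa>) (x <+ \<aa> i)" and "x \<in> x <+ \<aa> i"
proof -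
  interpret I: ideal "\<aa> i" R by (rule ideal_filtration)
  have "(x \<oplus> u) <+ \<aa> i \<subseteq> x <+ \<aa> i" if "u \<in> \<aa> i" for u
    using assms that I.a_closed by (fastforce simp: a_l_coset_def' a_assoc)
  moreover have "x <+ \<aa> i \<subseteq> carrier R"
    using assms by (auto simp: a_l_coset_def')
  moreover have "\<exists>u\<in>\<aa> i. y = x \<oplus> u" if "y \<in> x <+ \<aa> i" for y
    using that by (auto simp: a_l_coset_def')
  ultimately show "openin (filtration_topology R \<aa>) (x <+ \<aa> i)"
    unfolding openin_filtration_topology by metis
  show "x \<in> x <+ \<aa> i"
    using assms I.zero_closed by (force simp: a_l_coset_def')
qed

end

lemma linearly_finer_imp_finer:
  assumes "ideal_filtration R \<aa>" and "ideal_filtration R \<bb>" and "linearly_finer \<aa> \<bb>"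
    and "openin (filtration_topology R \<bb>) U"
  shows "openin (filtration_topology R \<aa>) U"
proof -
  obtain m c where *: "\<aa> (m * i + c) \<subseteq> \<bb> i" for i
    using assms(3) unfolding linearly_finer_def by blast
  have "x <+\<^bsub>R\<^esub> \<aa> (m * i + c) \<subseteq> x <+\<^bsub>R\<^esub> \<bb> i" for x i
    using * by (auto simp: a_l_coset_def')
  with assms(4) show ?thesis
    unfolding ideal_filtration.openin_filtration_topology[OF assms(1)]
      ideal_filtration.openin_filtration_topology[OF assms(2)]
    by (meson order_trans)
qed

end

theory Submission
  imports Defs
begin

text \<open>Call \<open>(s, r)\<close> a failure if
  \<open>\<not> \<aa> s \<subseteq> \<bb> r\<close>; both conditions say that \<open>s\<close> grows
  at most linearly in \<open>r\<close> along failures. If \<open>m * x + c\<close> witnesses linear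
  fineness, antitonicity of \<open>\<aa>\<close> forces
  \<open>s < m * r + c \<le> (m + c) * r\<close> at a failure, so the resurgence is at most
  \<open>m + c\<close> (\<open>linearly_finer_imp_resurgence_finite\<close>). Conversely, for a
  positive integer N above the resurgence, the pair (N i, i) has ratio N and cannot be a failure, so
  N x is a witness (\<open>resurgence_finite_imp_linearly_finer\<close>).\<close>

lemma resurgence_le_iff:
  "resurgence \<aa> \<bb> \<le> C \<longleftrightarrow>
     (\<forall>s\<ge>1. \<forall>r\<ge>1. \<not> \<aa> s \<subseteq> \<bb> r \<longrightarrow> ereal (real s / real r) \<le> C)"
  unfolding resurgence_def Sup_le_iff by blast

lemma linearly_finer_imp_resurgence_finite:
  assumes "antimono \<aa>" and "linearly_finer \<aa> \<bb>"
  shows "resurgence \<aa> \<bb> < \<infinity>"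
proof -
  obtain m c where sub: "\<aa> (m * i + c) \<subseteq> \<bb> i" for i
    using assms(2) unfolding linearly_finer_def by blast
  have "real s / real r \<le> real (m + c)" if "r \<ge> 1" "\<not> \<aa> s \<subseteq> \<bb> r" for s r
  proof -
    \<comment> \<open>Otherwise
      \<open>\<aa> s \<subseteq> \<aa> (m * r + c) \<subseteq> \<bb> r\<close>.\<close>
    have "\<not> m * r + c \<le> s"
      using that(2) sub[of r] antimonoD[OF assms(1)] by blast
    \<comment> \<open>As \<open>r \<ge> 1\<close>, the constant term can be absorbed into the
      slope.\<close>
    moreover have "c \<le> c * r"
      using that(1) by simp
    ultimately have "s \<le> (m + c) * r"
      unfolding add_mult_distrib by linarith
    then have "real s \<le> real (m + c) * real r"
      by (metis of_nat_le_iff of_nat_mult)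
    then show ?thesis
      using that(1) by (simp add: pos_divide_le_eq)
  qed
  then have "resurgence \<aa> \<bb> \<le> ereal (real (m + c))"
    unfolding resurgence_le_iff by simp
  then show ?thesis
    by (rule le_less_trans) simp
qed

text \<open>The supremum only sees positive indices, so the inclusion at index 0 is a separate
  hypothesis.\<close>

lemma resurgence_finite_imp_linearly_finer:
  assumes "\<aa> 0 \<subseteq> \<bb> 0" and "resurgence \<aa> \<bb> < \<infinity>"
  shows "linearly_finer \<aa> \<bb>"
proof -
  obtain n :: nat where "resurgence \<aa> \<bb> < ereal (real n)"
    using assms(2) less_PInf_Ex_of_nat by auto
  \<comment> \<open>\<open>n\<close> may be 0 when there are no failures and the supremum is
    -\<infinity>; passing to \<open>Suc n\<close> makes the slope positive, so that
    \<open>Suc n * i\<close> is an admissible \<open>s\<close> for \<open>i \<ge> 1\<close>.\<close>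
  also have "\<dots> < ereal (real (Suc n))"
    by simp
  finally have n: "resurgence \<aa> \<bb> < ereal (real (Suc n))" .
  have "\<aa> (Suc n * i + 0) \<subseteq> \<bb> i" for i
  proof (cases "i = 0")
    case True
    then show ?thesis using assms(1) by simp
  next
    case False
    show ?thesis
    proof (rule ccontr)
      assume "\<not> ?thesis"
      moreover have "Suc n * i \<ge> 1" "i \<ge> 1"
        using False by simp_all
      \<comment> \<open>Taking the resurgence itself as \<open>C\<close> in
        \<open>resurgence_le_iff\<close> bounds the ratio of every failure.\<close>
      ultimately have "ereal (real (Suc n * i) / real i) \<le> resurgence \<aa> \<bb>"
        using iffD1[OF resurgence_le_iff order_refl, of \<aa> \<bb>] by (metis add_0_right)
      moreover have "real (Suc n * i) / real i = real (Suc n)"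
        using False by (simp add: field_simps)
      ultimately show False
        using n by simp
    qed
  qed
  then show ?thesis
    unfolding linearly_finer_def by blast
qed

theorem theorem6p7:
  fixes S :: "('a, 'm) ring_scheme" (structure)
    and \<aa> \<bb> :: "nat \<Rightarrow> 'a set"
  assumes "cring S" and "noetherian_ring S"
    and "ideal_filtration S \<aa>" and "ideal_filtration S \<bb>"
  shows "linearly_finer \<aa> \<bb> \<longleftrightarrow> resurgence \<aa> \<bb> < \<infinity>"
proof
  have "antimono \<aa>"
    using ideal_filtration.filtration_antimono[OF assms(3)] by (rule antimonoI)
  then show "linearly_finer \<aa> \<bb> \<Longrightarrow> resurgence \<aa> \<bb> < \<infinity>"
    by (rule linearly_finer_imp_resurgence_finite)
  have "\<aa> 0 \<subseteq> \<bb> 0"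
    using assms(3,4) by (simp add: ideal_filtration.filtration_0)
  then show "resurgence \<aa> \<bb> < \<infinity> \<Longrightarrow> linearly_finer \<aa> \<bb>"
    by (rule resurgence_finite_imp_linearly_finer)
qed

end
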